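(* Let $k\geq 2$ be an integer and let $G=(V,E)$ be a hypergraph of rank $r$ with minimum degree $\delta(G)\geq 2rk^2$. Then $G$ has a $\frac{1}{k}$-majority $(k+1)$-edge-colouring.
   Context: A hypergraph $G=(V,E)$ consists of a finite vertex set $V$ and a collection $E$ of non-empty subsets of $V$ (hyperedges). The degree $d(v)$ of $v\in V$ is the number of hyperedges containing $v$; the minimum degree is $\delta(G)=\min_{v\in V} d(v)$; the rank of $G$ is $r=\max_{e\in E}|e|$. For an integer $k\geq 2$, a $\frac{1}{k}$-majority $(k+1)$-edge-colouring of $G$ is a map $c:E\to\{1,\dots,k+1\}$ such that for every vertex $v$ and every colour $i$, the number of hyperedges $e\ni v$ with $c(e)=i$ is at most $\lfloor d(v)/k\rfloor$. *)

theory Defs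
  imports Main "HOL-Library.FuncSet"
begin

definition hypergraph :: "'v set \<Rightarrow> 'v set set \<Rightarrow> bool" where
  "hypergraph V E \<longleftrightarrow> finite V \<and> (\<forall>e\<in>E. e \<noteq> {} \<and> e \<subseteq> V)"

definition hyper_degree :: "'v set set \<Rightarrow> 'v \<Rightarrow> nat" where
  "hyper_degree E v = card {e \<in> E. v \<in> e}"

text \<open>
  Minimum degree and rank are meaningful only for non-empty \<open>V\<close> and \<open>E\<close> respectively:
  \<open>Min {}\<close> and \<open>Max {}\<close> are unspecified.  A hypergraph without vertices or without
  hyperedges satisfies the colouring condition below trivially, whatever these values are.
\<close>

definition hyper_min_degree :: "'v set \<Rightarrow> 'v set set \<Rightarrow> nat" where
  "hyper_min_degree V E = Min (hyper_degree E ` V)"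

definition hyper_rank :: "'v set set \<Rightarrow> nat" where
  "hyper_rank E = Max (card ` E)"

text \<open>\<open>div\<close> on \<open>nat\<close> is the floor of the quotient.\<close>

definition majority_edge_colouring ::
  "nat \<Rightarrow> 'v set \<Rightarrow> 'v set set \<Rightarrow> ('v set \<Rightarrow> nat) \<Rightarrow> bool" where
  "majority_edge_colouring k V E c \<longleftrightarrow>
     c \<in> E \<rightarrow> {1..k + 1} \<and>
     (\<forall>v\<in>V. \<forall>i\<in>{1..k + 1}. card {e \<in> E. v \<in> e \<and> c e = i} \<le> hyper_degree E v div k)"

end

theory Submission
  imports Defs Complex_Main
begin

text \<open>
  The proof rounds the fractional colouring that gives every pair (hyperedge, colour) the weight
  \<open>1 / (k + 1)\<close>, keeping the total weight of every hyperedge equal to 1. A constraint \<open>(v, i)\<close> is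
  dropped as soon as at most \<open>d(v) div k\<close> hyperedges at \<open>v\<close> have positive weight in colour \<open>i\<close>:
  weights \<open>0\<close> and \<open>1\<close> are never changed again, so from then on it cannot be violated. In a
  constraint that is still active the positive weights sum to \<open>d(v) / (k + 1)\<close>, hence their defects
  \<open>1 - x\<close> sum to more than \<open>d(v) / k - d(v) / (k + 1) \<ge> r\<close>. Each defect is counted by at most \<open>r\<close>
  vertices, and the total defect is the number of fractional weights minus the number of hyperedges
  carrying one. So there are more fractional weights than active equations, and one can move along
  a kernel direction until another weight becomes integral.
\<close>

section \<open>Kernel directions\<close>

text \<open>Gaussian elimination, one equation at a time: an equation vanishing on \<open>F\<close>
  is discarded, any other is used to eliminate a pivot unknown.\<close>

lemma homogeneous_system_nontrivial:
  fixes a :: "'c \<Rightarrow> 'j \<Rightarrow> 'a::field"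
  assumes "finite C" "finite F" "card C < card F"
  shows "\<exists>y. (\<exists>j\<in>F. y j \<noteq> 0) \<and> (\<forall>c\<in>C. (\<Sum>j\<in>F. a c j * y j) = 0)"
  using assms
proof (induction C arbitrary: F a rule: finite_induct)
  case empty
  then obtain j where "j \<in> F" by fastforce
  then show ?case by (intro exI[of _ "\<lambda>_. 1"]) auto
next
  case (insert c C)
  show ?case
  proof (cases "\<forall>j\<in>F. a c j = 0")
    case True
    have "card C < card F" using insert by simp
    from insert.IH[OF insert.prems(1) this, of a] obtain y
      where "\<exists>j\<in>F. y j \<noteq> 0" "\<forall>c\<in>C. (\<Sum>j\<in>F. a c j * y j) = 0" by blast
    with True show ?thesis by (intro exI[of _ y]) auto
  next
    case False
    then obtain p where p: "p \<in> F" "a c p \<noteq> 0" by blast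
    define F' where "F' = F - {p}"
    have F': "finite F'" "p \<notin> F'" "F = insert p F'"
      using p insert.prems by (auto simp: F'_def)
    have "card C < card F'" using insert F' by simp
    from insert.IH[OF F'(1) this, of "\<lambda>d j. a d j - a d p * a c j / a c p"] obtain y where
      y: "\<exists>j\<in>F'. y j \<noteq> 0"
        "\<And>d. d \<in> C \<Longrightarrow> (\<Sum>j\<in>F'. (a d j - a d p * a c j / a c p) * y j) = 0" by blast
    define z where "z = y(p := - (\<Sum>j\<in>F'. a c j * y j) / a c p)"
    have sum_z: "(\<Sum>j\<in>F. a d j * z j)
        = (\<Sum>j\<in>F'. a d j * y j) - a d p * (\<Sum>j\<in>F'. a c j * y j) / a c p" for d
    proof -
      have "(\<Sum>j\<in>F'. a d j * z j) = (\<Sum>j\<in>F'. a d j * y j)"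
        using F'(2) by (intro sum.cong) (auto simp: z_def)
      then show ?thesis using F' by (simp add: z_def)
    qed
    have "(\<Sum>j\<in>F. a d j * z j) = 0" if "d \<in> C" for d
      using y(2)[OF that] unfolding sum_z
      by (simp add: left_diff_distrib sum_subtractf sum_distrib_left sum_divide_distrib mult.assoc)
    moreover have "(\<Sum>j\<in>F. a c j * z j) = 0"
      unfolding sum_z using p by simp
    moreover have "\<exists>j\<in>F. z j \<noteq> 0"
      using y(1) F' by (auto simp: z_def)
    ultimately show ?thesis by blast
  qed
qed

text \<open>Starting inside the open cube, follow the line in direction \<open>y\<close> until it
  first meets the boundary.\<close>

lemma move_to_cube_boundary:
  fixes x y :: "'j \<Rightarrow> real"
  assumes "finite F" "\<And>j. j \<in> F \<Longrightarrow> 0 < x j \<and> x j < 1" "\<exists>j\<in>F. y j \<noteq> 0"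
  shows "\<exists>t. (\<forall>j\<in>F. 0 \<le> x j + t * y j \<and> x j + t * y j \<le> 1) \<and>
             (\<exists>j\<in>F. x j + t * y j = 0 \<or> x j + t * y j = 1)"
proof -
  \<comment> \<open>For \<open>y j \<noteq> 0\<close>, \<open>g j\<close> is the time at which
    coordinate \<open>j\<close> reaches 1 (if increasing) or 0 (if decreasing). A constant
    coordinate must be excluded from the minimum, since division by zero would give it exit time
    0.\<close>
  define g where "g j = (if y j > 0 then (1 - x j) / y j else - x j / y j)" for j
  define F' where "F' = {j \<in> F. y j \<noteq> 0}"
  define t where "t = Min (g ` F')"
  have F': "finite (g ` F')" "g ` F' \<noteq> {}" using assms by (auto simp: F'_def)
  have "t \<in> g ` F'" unfolding t_def by (rule Min_in[OF F'])
  then obtain p where p: "p \<in> F" "y p \<noteq> 0" "t = g p" by (auto simp: F'_def)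
  have "t > 0" using p assms(2)[OF p(1)]
    by (cases "y p > 0") (auto simp: g_def divide_neg_neg divide_pos_neg)
  have "0 \<le> x j + t * y j \<and> x j + t * y j \<le> 1" if "j \<in> F" for j
  proof (cases "y j = 0")
    case True
    then show ?thesis using assms(2)[OF that] by simp
  next
    case False
    then have le: "t \<le> g j" unfolding t_def using F' that by (auto simp: F'_def intro!: Min_le)
    show ?thesis
    proof (cases "y j > 0")
      case True
      have "t * y j \<le> 1 - x j" using le True by (simp add: g_def pos_le_divide_eq)
      moreover have "0 < t * y j" using True \<open>t > 0\<close> by simp
      ultimately show ?thesis using assms(2)[OF that] by linarith
    next
      case neg: False
      have "- x j \<le> t * y j" using le neg False by (simp add: g_def neg_le_minus_divide_eq)
      moreover have "t * y j < 0" using neg False \<open>t > 0\<close> by (simp add: mult_pos_neg)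
      ultimately show ?thesis using assms(2)[OF that] by linarith
    qed
  qed
  moreover have "x p + t * y p = 0 \<or> x p + t * y p = 1" using p by (auto simp: g_def)
  ultimately show ?thesis using p(1) by blast
qed

section \<open>Fractional colourings\<close>

text \<open>In the application \<open>b v\<close> is d(v) / (k + 1), the column sum to be preserved,
  and \<open>m v\<close> is the bound on each colour at \<open>v\<close>. The disjunction expresses
  dropped constraints through the current weights alone, without a history.\<close>

definition admissible_weighting ::
  "'v set \<Rightarrow> 'v set set \<Rightarrow> 'i set \<Rightarrow> ('v \<Rightarrow> real) \<Rightarrow> ('v \<Rightarrow> nat) \<Rightarrow> ('v set \<times> 'i \<Rightarrow> real) \<Rightarrow> bool"
where
  "admissible_weighting V E I b m x \<longleftrightarrow>
     (\<forall>p\<in>E \<times> I. 0 \<le> x p \<and> x p \<le> 1) \<and>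
     (\<forall>e\<in>E. (\<Sum>i\<in>I. x (e, i)) = 1) \<and>
     (\<forall>v\<in>V. \<forall>i\<in>I. (\<Sum>e | e \<in> E \<and> v \<in> e. x (e, i)) = b v \<or>
                   card {e \<in> E. v \<in> e \<and> 0 < x (e, i)} \<le> m v)"

definition fractional_pairs :: "'e set \<Rightarrow> 'i set \<Rightarrow> ('e \<times> 'i \<Rightarrow> real) \<Rightarrow> ('e \<times> 'i) set" where
  "fractional_pairs E I x = {p \<in> E \<times> I. 0 < x p \<and> x p < 1}"

definition active_constraints ::
  "'v set \<Rightarrow> 'v set set \<Rightarrow> 'i set \<Rightarrow> ('v \<Rightarrow> nat) \<Rightarrow> ('v set \<times> 'i \<Rightarrow> real) \<Rightarrow> ('v \<times> 'i) set" where
  "active_constraints V E I m x =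
     {(v, i) \<in> V \<times> I. m v < card {e \<in> E. v \<in> e \<and> 0 < x (e, i)}}"

section \<open>Double counting of defects\<close>

text \<open>A hyperedge with a fractional weight has no weight 1, so its fractional weights alone
  sum to 1.\<close>

lemma sum_fractional_pairs:
  assumes "finite E" "finite I" "\<And>p. p \<in> E \<times> I \<Longrightarrow> 0 \<le> x p \<and> x p \<le> 1"
    and "\<And>e. e \<in> E \<Longrightarrow> (\<Sum>i\<in>I. x (e, i)) = 1"
  shows "sum x (fractional_pairs E I x) = real (card (fst ` fractional_pairs E I x))"
proof -
  let ?F = "fractional_pairs E I x"
  have fin: "finite ?F" using assms(1,2) by (simp add: fractional_pairs_def)
  have row: "(\<Sum>p\<in>{p \<in> ?F. fst p = e}. x p) = 1" if e: "e \<in> fst ` ?F" for e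
  proof -
    obtain j where j: "e \<in> E" "j \<in> I" "0 < x (e, j)" "x (e, j) < 1"
      using e by (auto simp: fractional_pairs_def)
    have lt1: "x (e, i) < 1" if i: "i \<in> I" for i
    proof (rule ccontr)
      assume "\<not> x (e, i) < 1"
      then have "x (e, i) = 1" "i \<noteq> j" using assms(3)[of "(e, i)"] i j by auto
      moreover have "sum (\<lambda>i. x (e, i)) {i, j} \<le> (\<Sum>i\<in>I. x (e, i))"
        using assms(2,3) i j by (intro sum_mono2) auto
      ultimately show False using assms(4)[OF j(1)] j by simp
    qed
    have "1 = (\<Sum>i\<in>{i\<in>I. 0 < x (e, i)}. x (e, i))"
      unfolding assms(4)[OF j(1), symmetric]
    proof (rule sum.mono_neutral_right)
      show "\<forall>i\<in>I - {i\<in>I. 0 < x (e, i)}. x (e, i) = 0"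
        using assms(3) j(1) by (force simp: not_less intro: antisym)
    qed (use assms(2) in auto)
    also have "\<dots> = (\<Sum>p\<in>{p \<in> ?F. fst p = e}. x p)"
      using lt1 j(1)
      by (intro sum.reindex_bij_witness[of _ snd "Pair e"]) (auto simp: fractional_pairs_def)
    finally show ?thesis by simp
  qed
  have "sum x ?F = (\<Sum>e\<in>fst ` ?F. \<Sum>p\<in>{p \<in> ?F. fst p = e}. x p)"
    by (rule sum.image_gen[OF fin])
  also have "\<dots> = real (card (fst ` ?F))" using row by simp
  finally show ?thesis .
qed

lemma card_active_constraints:
  fixes V :: "'v set" and E :: "'v set set" and I :: "'i set"
  assumes fin: "finite V" "finite I" and E: "\<And>e. e \<in> E \<Longrightarrow> e \<subseteq> V \<and> card e \<le> r"
    and slack: "\<And>v. v \<in> V \<Longrightarrow> b v + real r < real (m v) + 1"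
    and adm: "admissible_weighting V E I b m x"
    and ne: "fractional_pairs E I x \<noteq> {}"
  shows "card (active_constraints V E I m x) + card (fst ` fractional_pairs E I x)
           < card (fractional_pairs E I x)"
proof -
  let ?F = "fractional_pairs E I x" and ?A = "active_constraints V E I m x"
  have finE: "finite E" using fin(1) E by (meson PowI finite_Pow_iff finite_subset subsetI)
  have finF: "finite ?F" and finA: "finite ?A"
    using fin finE
    by (auto simp: fractional_pairs_def active_constraints_def
        intro: finite_subset[of _ "V \<times> I"])
  have x01: "0 \<le> x p \<and> x p \<le> 1" if "p \<in> E \<times> I" for p
    using adm that unfolding admissible_weighting_def by blast
  have defect: "(\<Sum>p\<in>?F. 1 - x p) = real (card ?F) - real (card (fst ` ?F))"
    using sum_fractional_pairs[OF finE fin(2) x01] adm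
    by (simp add: sum_subtractf admissible_weighting_def)
  have x0: "x p = 0" if "p \<in> E \<times> I" "\<not> 0 < x p" for p
    using x01[OF that(1)] that(2) by simp
  show ?thesis
  proof (cases "?A = {}")
    case True
    have "0 < (\<Sum>p\<in>?F. 1 - x p)"
      using ne finF by (intro sum_pos) (auto simp: fractional_pairs_def)
    with defect True show ?thesis by simp
  next
    case False
    \<comment> \<open>The total defect of a column. Weights equal to 1 are included but contribute
      0.\<close>
    define D where "D v i = (\<Sum>e | e \<in> E \<and> v \<in> e \<and> 0 < x (e, i). 1 - x (e, i))" for v i
    have D_large: "real r < D v i" if vi: "(v, i) \<in> ?A" for v i
    proof -
      have *: "v \<in> V" "i \<in> I" "m v < card {e \<in> E. v \<in> e \<and> 0 < x (e, i)}"
        using vi by (auto simp: active_constraints_def)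
      have "(\<Sum>e | e \<in> E \<and> v \<in> e. x (e, i)) = b v"
        using adm * unfolding admissible_weighting_def by (meson leD)
      then have "b v = (\<Sum>e | e \<in> E \<and> v \<in> e. x (e, i))" by simp
      also have "\<dots> = (\<Sum>e | e \<in> E \<and> v \<in> e \<and> 0 < x (e, i). x (e, i))"
        using finE x0 *(2) by (intro sum.mono_neutral_right) auto
      finally have "D v i = real (card {e \<in> E. v \<in> e \<and> 0 < x (e, i)}) - b v"
        by (simp add: D_def sum_subtractf)
      \<comment> \<open>By integrality an active column has at least \<open>m v + 1\<close> positive
        weights, which is where the \<open>+ 1\<close> in \<open>slack\<close> comes from.\<close>
      with slack[OF *(1)] *(3) show ?thesis by linarith
    qed
    have D_nonneg: "0 \<le> D v i" if "i \<in> I" for v i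
      unfolding D_def using x01 that by (intro sum_nonneg) auto
    have "real r * real (card ?A) = (\<Sum>p\<in>?A. real r)" by simp
    also have "\<dots> < (\<Sum>(v, i)\<in>?A. D v i)"
      using False finA D_large by (intro sum_strict_mono) auto
    also have "\<dots> \<le> (\<Sum>(v, i)\<in>V \<times> I. D v i)"
      using fin D_nonneg by (intro sum_mono2) (auto simp: active_constraints_def)
    also have "\<dots> = (\<Sum>v\<in>V. \<Sum>i\<in>I. \<Sum>e\<in>E. if v \<in> e \<and> 0 < x (e, i) then 1 - x (e, i) else 0)"
      unfolding D_def sum.cartesian_product[symmetric] using finE by (simp add: sum.inter_filter)
    also have "\<dots> = (\<Sum>v\<in>V. \<Sum>(e, i)\<in>E \<times> I. if v \<in> e \<and> 0 < x (e, i) then 1 - x (e, i) else 0)"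
      unfolding sum.cartesian_product[symmetric] by (intro sum.cong refl sum.swap)
    \<comment> \<open>Outside \<open>?F\<close> a weight is 0 and fails the condition, or is 1 and
      has defect 0.\<close>
    also have "\<dots> = (\<Sum>v\<in>V. \<Sum>p\<in>?F. if v \<in> fst p then 1 - x p else 0)"
    proof (rule sum.cong[OF refl], rule sum.mono_neutral_cong_right)
      fix v
      have "\<not> 0 < x p \<or> x p = 1" if "p \<in> E \<times> I - ?F" for p
        using that x01[of p] by (auto simp: fractional_pairs_def)
      then show "\<forall>p\<in>E \<times> I - ?F.
          (case p of (e, i) \<Rightarrow> if v \<in> e \<and> 0 < x (e, i) then 1 - x (e, i) else 0) = 0"
        by fastforce
    qed (use finE fin(2) in \<open>auto simp: fractional_pairs_def\<close>)
    also have "\<dots> = (\<Sum>p\<in>?F. \<Sum>v\<in>V. if v \<in> fst p then 1 - x p else 0)"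
      by (rule sum.swap)
    \<comment> \<open>Each nonnegative defect is counted once per vertex of its hyperedge, hence at
      most \<open>r\<close> times.\<close>
    also have "\<dots> \<le> (\<Sum>p\<in>?F. real r * (1 - x p))"
    proof (intro sum_mono)
      fix p assume p: "p \<in> ?F"
      then have "fst p \<in> E" "x p < 1" by (auto simp: fractional_pairs_def)
      moreover have "V \<inter> {v. v \<in> fst p} = fst p" using E[OF \<open>fst p \<in> E\<close>] by blast
      ultimately show "(\<Sum>v\<in>V. if v \<in> fst p then 1 - x p else 0) \<le> real r * (1 - x p)"
        using E fin(1) by (simp add: sum.If_cases mult_right_mono)
    qed
    also have "\<dots> = real r * (real (card ?F) - real (card (fst ` ?F)))"
      by (simp add: defect[symmetric] sum_distrib_left)
    finally have "real (card ?A) < real (card ?F) - real (card (fst ` ?F))"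
      by (simp add: mult_less_cancel_left)
    then show ?thesis by linarith
  qed
qed

section \<open>Rounding along kernel directions\<close>

lemma rounding_step:
  fixes V :: "'v set" and E :: "'v set set" and I :: "'i set"
  assumes fin: "finite V" "finite I" and E: "\<And>e. e \<in> E \<Longrightarrow> e \<subseteq> V \<and> card e \<le> r"
    and slack: "\<And>v. v \<in> V \<Longrightarrow> b v + real r < real (m v) + 1"
    and adm: "admissible_weighting V E I b m x"
    and ne: "fractional_pairs E I x \<noteq> {}"
  shows "\<exists>x'. admissible_weighting V E I b m x' \<and>
              fractional_pairs E I x' \<subset> fractional_pairs E I x"
proof -
  let ?F = "fractional_pairs E I x" and ?A = "active_constraints V E I m x"
  have finE: "finite E" using fin(1) E by (meson PowI finite_Pow_iff finite_subset subsetI)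
  have finF: "finite ?F" and finA: "finite ?A"
    using fin finE
    by (auto simp: fractional_pairs_def active_constraints_def
        intro: finite_subset[of _ "V \<times> I"])
  \<comment> \<open>The unknowns are the fractional pairs. \<open>Inl\<close> indexes the column
    equations of active constraints, \<open>Inr\<close> the row equations of hyperedges carrying a
    fractional weight.\<close>
  define a :: "('v \<times> 'i) + 'v set \<Rightarrow> 'v set \<times> 'i \<Rightarrow> real" where
    "a c p = (case c of Inl (v, i) \<Rightarrow> of_bool (v \<in> fst p \<and> snd p = i) | Inr e \<Rightarrow> of_bool (fst p = e))"
    for c p
  have "card (?A <+> fst ` ?F) < card ?F"
    using card_active_constraints[OF assms] finA finF by (simp add: card_Plus)
  then obtain y where y: "\<exists>p\<in>?F. y p \<noteq> 0" "\<And>c. c \<in> ?A <+> fst ` ?F \<Longrightarrow> (\<Sum>p\<in>?F. a c p * y p) = 0"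
    using homogeneous_system_nontrivial[of "?A <+> fst ` ?F" ?F a] finA finF by auto
  obtain t where t: "\<And>p. p \<in> ?F \<Longrightarrow> 0 \<le> x p + t * y p \<and> x p + t * y p \<le> 1"
      "\<exists>p\<in>?F. x p + t * y p = 0 \<or> x p + t * y p = 1"
    using move_to_cube_boundary[OF finF _ y(1), of x] by (auto simp: fractional_pairs_def)
  \<comment> \<open>Extending \<open>y\<close> by 0 freezes all integral weights.\<close>
  define z where "z p = (if p \<in> ?F then y p else 0)" for p
  define x' where "x' p = x p + t * z p" for p
  have x'_eq: "x' p = x p" if "p \<notin> ?F" for p using that by (simp add: x'_def z_def)
  have x01: "0 \<le> x p \<and> x p \<le> 1" if "p \<in> E \<times> I" for p
    using adm that unfolding admissible_weighting_def by blast
  have x'01: "0 \<le> x' p \<and> x' p \<le> 1" if "p \<in> E \<times> I" for p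
    using x01[OF that] t(1)[of p] by (cases "p \<in> ?F") (simp_all add: x'_def z_def)
  \<comment> \<open>Weights 0 stay 0, so supports only shrink and a dropped constraint remains
    dropped.\<close>
  have pos: "0 < x p" if "p \<in> E \<times> I" "0 < x' p" for p
    using that x'_eq[of p] by (cases "p \<in> ?F") (auto simp: fractional_pairs_def)
  have zrow: "(\<Sum>i\<in>I. z (e, i)) = 0" if e: "e \<in> E" for e
  proof (cases "e \<in> fst ` ?F")
    case True
    then have "0 = (\<Sum>p\<in>?F. of_bool (fst p = e) * y p)"
      using y(2)[of "Inr e"] by (simp add: a_def InrI)
    also have "\<dots> = (\<Sum>p\<in>E \<times> I. of_bool (fst p = e) * z p)"
      using finE fin(2)
      by (intro sum.mono_neutral_cong_left) (auto simp: z_def fractional_pairs_def)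
    also have "\<dots> = (\<Sum>f\<in>E. \<Sum>i\<in>I. of_bool (f = e) * z (f, i))"
      by (simp add: sum.cartesian_product case_prod_unfold)
    also have "\<dots> = (\<Sum>i\<in>I. z (e, i))"
      using finE e by (subst sum.swap) (simp add: of_bool_def if_distrib[of "\<lambda>u. u * _"] cong: if_cong)
    finally show ?thesis by simp
  next
    case False
    then have "z (e, i) = 0" for i by (force simp: z_def)
    then show ?thesis by simp
  qed
  have zcol: "(\<Sum>e | e \<in> E \<and> v \<in> e. z (e, i)) = 0" if vi: "(v, i) \<in> ?A" for v i
  proof -
    have i: "i \<in> I" using vi by (simp add: active_constraints_def)
    have "0 = (\<Sum>p\<in>?F. of_bool (v \<in> fst p \<and> snd p = i) * y p)"
      using y(2)[of "Inl (v, i)"] vi by (simp add: a_def InlI)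
    also have "\<dots> = (\<Sum>p\<in>E \<times> I. of_bool (v \<in> fst p \<and> snd p = i) * z p)"
      using finE fin(2)
      by (intro sum.mono_neutral_cong_left) (auto simp: z_def fractional_pairs_def)
    also have "\<dots> = (\<Sum>e\<in>E. \<Sum>j\<in>I. if j = i then of_bool (v \<in> e) * z (e, j) else 0)"
      by (auto simp: sum.cartesian_product case_prod_unfold intro!: sum.cong)
    also have "\<dots> = (\<Sum>e\<in>E. if v \<in> e then z (e, i) else 0)"
      using fin(2) i by (intro sum.cong) auto
    also have "\<dots> = (\<Sum>e | e \<in> E \<and> v \<in> e. z (e, i))"
      using finE by (simp add: sum.inter_filter)
    finally show ?thesis by simp
  qed
  have "admissible_weighting V E I b m x'"
    unfolding admissible_weighting_def
  proof (intro conjI ballI)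
    fix e assume "e \<in> E"
    then show "(\<Sum>i\<in>I. x' (e, i)) = 1"
      using adm zrow by (simp add: x'_def sum.distrib sum_distrib_left[symmetric] admissible_weighting_def)
  next
    fix v i assume vi: "v \<in> V" "i \<in> I"
    have "card {e \<in> E. v \<in> e \<and> 0 < x' (e, i)} \<le> card {e \<in> E. v \<in> e \<and> 0 < x (e, i)}"
      using finE pos vi by (intro card_mono) auto
    moreover have "(\<Sum>e | e \<in> E \<and> v \<in> e. x' (e, i)) = b v" if "(v, i) \<in> ?A"
    proof -
      have "(\<Sum>e | e \<in> E \<and> v \<in> e. x (e, i)) = b v"
        using adm that unfolding admissible_weighting_def active_constraints_def by force
      then show ?thesis
        using zcol[OF that] by (simp add: x'_def sum.distrib sum_distrib_left[symmetric])
    qed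
    ultimately show "(\<Sum>e | e \<in> E \<and> v \<in> e. x' (e, i)) = b v \<or>
        card {e \<in> E. v \<in> e \<and> 0 < x' (e, i)} \<le> m v"
      using vi by (force simp: active_constraints_def)
  qed (use x'01 in blast)+
  moreover have "fractional_pairs E I x' \<subseteq> ?F"
  proof
    fix p assume p: "p \<in> fractional_pairs E I x'"
    show "p \<in> ?F"
    proof (rule ccontr)
      assume "p \<notin> ?F"
      with p x'_eq[OF this] show False by (simp add: fractional_pairs_def)
    qed
  qed
  moreover obtain p where "p \<in> ?F" "x' p = 0 \<or> x' p = 1"
    using t(2) by (auto simp: x'_def z_def)
  then have "p \<in> ?F - fractional_pairs E I x'" by (auto simp: fractional_pairs_def)
  ultimately show ?thesis by blast
qed

lemma exists_integral_weighting:
  fixes V :: "'v set" and E :: "'v set set" and I :: "'i set"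
  assumes fin: "finite V" "finite I" and E: "\<And>e. e \<in> E \<Longrightarrow> e \<subseteq> V \<and> card e \<le> r"
    and slack: "\<And>v. v \<in> V \<Longrightarrow> b v + real r < real (m v) + 1"
    and adm: "admissible_weighting V E I b m x"
  shows "\<exists>x'. admissible_weighting V E I b m x' \<and> fractional_pairs E I x' = {}"
  using adm
proof (induction "card (fractional_pairs E I x)" arbitrary: x rule: less_induct)
  case less
  have "finite E" using fin(1) E by (meson PowI finite_Pow_iff finite_subset subsetI)
  then have finF: "finite (fractional_pairs E I x)"
    using fin(2) by (simp add: fractional_pairs_def)
  show ?case
  proof (cases "fractional_pairs E I x = {}")
    case False
    from rounding_step[OF fin E slack less.prems this] obtain x' where
      "admissible_weighting V E I b m x'" "fractional_pairs E I x' \<subset> fractional_pairs E I x"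
      by blast
    then show ?thesis using less.hyps psubset_card_mono[OF finF] by blast
  qed (use less.prems in blast)
qed

text \<open>In an integral weighting each row sum 1 forces a weight 1, whose colour is taken for the
  hyperedge.\<close>

lemma exists_colouring_bounded:
  fixes V :: "'v set" and E :: "'v set set" and I :: "'i set"
  assumes fin: "finite V" "finite I" and E: "\<And>e. e \<in> E \<Longrightarrow> e \<subseteq> V \<and> card e \<le> r"
    and slack: "\<And>v. v \<in> V \<Longrightarrow> b v + real r < real (m v) + 1"
    and adm: "admissible_weighting V E I b m x"
  shows "\<exists>c. c \<in> E \<rightarrow> I \<and> (\<forall>v\<in>V. \<forall>i\<in>I. card {e \<in> E. v \<in> e \<and> c e = i} \<le> m v)"
proof -
  have finE: "finite E" using fin(1) E by (meson PowI finite_Pow_iff finite_subset subsetI)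
  obtain x where x: "admissible_weighting V E I b m x" "fractional_pairs E I x = {}"
    using exists_integral_weighting[OF assms] by blast
  have x01: "x (e, i) = 0 \<or> x (e, i) = 1" if "e \<in> E" "i \<in> I" for e i
    using that x by (force simp: admissible_weighting_def fractional_pairs_def)
  have "\<exists>i\<in>I. x (e, i) = 1" if "e \<in> E" for e
  proof (rule ccontr)
    assume "\<not> ?thesis"
    then have "(\<Sum>i\<in>I. x (e, i)) = 0" using x01 that by (intro sum.neutral) blast
    then show False using x(1) that by (simp add: admissible_weighting_def)
  qed
  then obtain c where c: "\<And>e. e \<in> E \<Longrightarrow> c e \<in> I \<and> x (e, c e) = 1" by metis
  have "card {e \<in> E. v \<in> e \<and> c e = i} \<le> m v" if vi: "v \<in> V" "i \<in> I" for v i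
  proof -
    let ?P = "{e \<in> E. v \<in> e \<and> 0 < x (e, i)}"
    have "card {e \<in> E. v \<in> e \<and> c e = i} \<le> card ?P"
      using finE c by (intro card_mono) auto
    also have "card ?P \<le> m v"
    proof (rule ccontr)
      \<comment> \<open>Were the constraint still active, its column sum \<open>b v\<close> would
        equal the number of positive weights, at least \<open>m v + 1\<close>, against
        \<open>slack\<close>.\<close>
      assume *: "\<not> card ?P \<le> m v"
      then have "(\<Sum>e | e \<in> E \<and> v \<in> e. x (e, i)) = b v"
        using x(1) vi unfolding admissible_weighting_def by blast
      then have "b v = (\<Sum>e | e \<in> E \<and> v \<in> e. x (e, i))" by simp
      also have "\<dots> = (\<Sum>e\<in>?P. 1)"
      proof (rule sum.mono_neutral_cong_right)
        show "\<forall>e\<in>{e \<in> E. v \<in> e} - ?P. x (e, i) = 0"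
          using x01[OF _ vi(2)] zero_less_one by (metis (no_types, lifting) DiffE mem_Collect_eq)
        show "x (e, i) = 1" if "e \<in> ?P" for e
          using x01[OF _ vi(2), of e] that by auto
      qed (use finE in auto)
      finally have "b v = real (card ?P)" by simp
      with slack[OF vi(1)] * show False by linarith
    qed
    finally show ?thesis .
  qed
  with c show ?thesis by blast
qed

section \<open>Application to majority colourings\<close>

text \<open>The difference of d / k and d / (k + 1) is d / (k (k + 1)), which is at least
  \<open>r\<close> because k (k + 1) is at most 2 k^2; strictness comes from the floor in
  \<open>d div k\<close>.\<close>

lemma majority_slack:
  fixes d k r :: nat
  assumes "k \<ge> 2" "r \<ge> 1" "d \<ge> 2 * r * k\<^sup>2"
  shows "real d / real (k + 1) + real r < real (d div k) + 1"
proof -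
  have "k * (k + 1) \<le> 2 * k\<^sup>2" using assms(1) by (simp add: power2_eq_square)
  then have "r * (k * (k + 1)) \<le> d" using assms(3)
    by (metis (no_types, lifting) mult.assoc mult.commute mult_le_mono2 order_trans)
  then have "real r * (real k * (real k + 1)) \<le> real d"
    by (metis of_nat_1 of_nat_add of_nat_le_iff of_nat_mult)
  then have "real r \<le> real d / (real k * (real k + 1))"
    using assms(1) by (simp add: pos_le_divide_eq)
  also have "\<dots> = real d / real k - real d / (real k + 1)"
    using assms(1) by (simp add: field_simps)
  finally have "real r + real d / (real k + 1) \<le> real d / real k" by simp
  also have "real d / real k < real (d div k) + 1"
  proof -
    have "d < (d div k + 1) * k" using assms(1)
      by (metis add.commute div_mult_mod_eq mod_less_divisor mult.commute nat_add_left_cancel_less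
          add_mult_distrib2 mult_1_right not_numeral_le_zero not_gr_zero)
    then have "real d < (real (d div k) + 1) * real k"
      by (metis of_nat_1 of_nat_add of_nat_less_iff of_nat_mult)
    then show ?thesis using assms(1) by (simp add: pos_divide_less_eq)
  qed
  finally show ?thesis by (simp add: add.commute)
qed

theorem theorem2:
  fixes k r :: nat and V :: "'v set" and E :: "'v set set"
  assumes "k \<ge> 2"
    and "hypergraph V E"
    and "hyper_rank E = r"
    and "hyper_min_degree V E \<ge> 2 * r * k\<^sup>2"
  shows "\<exists>c. majority_edge_colouring k V E c"
proof (cases "E = {}")
  case True
  \<comment> \<open>Here \<open>hyper_rank E\<close> is the unspecified \<open>Max {}\<close>, so
    this case is treated apart; every count is 0.\<close>
  then show ?thesis by (simp add: majority_edge_colouring_def)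
next
  case False
  have finV: "finite V" and E: "\<And>e. e \<in> E \<Longrightarrow> e \<noteq> {} \<and> e \<subseteq> V"
    using assms(2) by (auto simp: hypergraph_def)
  have finE: "finite E" using finV E by (meson PowI finite_Pow_iff finite_subset subsetI)
  have rank: "card e \<le> r" if "e \<in> E" for e
    using finE that assms(3) by (auto simp: hyper_rank_def intro: Max_ge)
  obtain e where "e \<in> E" using False by blast
  with rank E finV have "r \<ge> 1"
    by (metis One_nat_def Suc_leI card_gt_0_iff finite_subset le_trans)
  define I where "I = {1..k + 1}"
  define x :: "'v set \<times> nat \<Rightarrow> real" where "x p = 1 / real (k + 1)" for p
  have slack: "real (hyper_degree E v) / real (k + 1) + real r < real (hyper_degree E v div k) + 1"
    if "v \<in> V" for v
  proof -
    have "hyper_min_degree V E \<le> hyper_degree E v"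
      using finV that by (auto simp: hyper_min_degree_def intro: Min_le)
    with assms(4) show ?thesis by (intro majority_slack assms(1) \<open>r \<ge> 1\<close>) simp
  qed
  \<comment> \<open>With uniform weights every row sums to 1 and every column at \<open>v\<close> to
    exactly d(v) / (k + 1), so the first disjunct holds throughout.\<close>
  have "admissible_weighting V E I (\<lambda>v. real (hyper_degree E v) / real (k + 1))
          (\<lambda>v. hyper_degree E v div k) x"
    by (simp add: admissible_weighting_def x_def I_def hyper_degree_def)
  from exists_colouring_bounded[OF finV _ _ slack this] show ?thesis
    using E rank by (auto simp: majority_edge_colouring_def I_def)
qed

end
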